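(* For every multiplicity vector $\boldsymbol m=(m_1,\ldots,m_n)$ of nonnegative integers and every $r\geq1$, $$H_{(m_1,\ldots,m_n,r)}(x,y)=\mathcal G_r\,H_{\boldsymbol m}(x,y).$$
   Context: For a vector $\boldsymbol m=(m_1,\ldots,m_n)$ of nonnegative integers, $\mathfrak S_{\boldsymbol m}$ is the set of permutations (words) of the multiset $\{1^{m_1},2^{m_2},\ldots,n^{m_n}\}$; zero multiplicities are ignored. Let $N=m_1+\cdots+m_n$. For $\pi=\pi_1\cdots\pi_N$, $\mathrm{des}(\pi)=\#\{i\in[N-1]:\pi_i>\pi_{i+1}\}$. If the multiset is nonempty, $$H_{\boldsymbol m}(x,y)=\sum_{\pi\in\mathfrak S_{\boldsymbol m}}x^{\mathrm{des}(\pi)+1}y^{N-\mathrm{des}(\pi)},$$ and for the empty multiset $H_\varnothing(x,y)=x$. With $D=\partial_x+\partial_y$, for $r\geq1$, $\mathcal G_r=y^r\sum_{j=1}^{r}\binom{r-1}{j-1}\frac{x^j}{j!}D^j$, an operator on $\mathbb Q[x,y]$. *)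

theory Defs
  imports
    "HOL-Combinatorics.Multiset_Permutations"
    "HOL-Computational_Algebra.Polynomial"
begin

text \<open>
  Elements of \<open>\<rat>[x,y]\<close> are represented as \<open>\<rat>[x][y]\<close>: the outer variable is \<open>y\<close>,
  the coefficients are polynomials in \<open>x\<close>.
\<close>

type_synonym bipoly = "rat poly poly"

definition var_x :: bipoly where
  "var_x = [:[:0, 1:]:]"

definition var_y :: bipoly where
  "var_y = [:0, 1:]"

definition const :: "rat \<Rightarrow> bipoly" where
  "const c = [:[:c:]:]"

definition partial_x :: "bipoly \<Rightarrow> bipoly" where
  "partial_x p = map_poly pderiv p"

definition partial_y :: "bipoly \<Rightarrow> bipoly" where
  "partial_y p = pderiv p"

definition D :: "bipoly \<Rightarrow> bipoly" where
  "D p = partial_x p + partial_y p"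

text \<open>
  A multiplicity vector \<open>(m\<^sub>1, \<dots>, m\<^sub>n)\<close> is the list \<open>[m\<^sub>1, \<dots>, m\<^sub>n]\<close>; list positions count
  from \<open>0\<close>, so position \<open>i\<close> carries the multiplicity of the letter \<open>i + 1\<close>.
\<close>

definition mult_mset :: "nat list \<Rightarrow> nat multiset" where
  "mult_mset m = (\<Sum>i<length m. replicate_mset (m ! i) (i + 1))"

definition des :: "nat list \<Rightarrow> nat" where
  "des w = card {i. i + 1 < length w \<and> w ! i > w ! (i + 1)}"

definition H :: "nat list \<Rightarrow> bipoly" where
  "H m = (if mult_mset m = {#} then var_x
          else \<Sum>w\<in>permutations_of_multiset (mult_mset m).
                 var_x ^ (des w + 1) * var_y ^ (sum_list m - des w))"

definition G :: "nat \<Rightarrow> bipoly \<Rightarrow> bipoly" where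
  "G r p = var_y ^ r *
     (\<Sum>j=1..r. const (of_nat ((r - 1) choose (j - 1)) / fact j) * var_x ^ j * (D ^^ j) p)"

end

theory Submission
  imports Defs
begin

text \<open>
  A word on the extended multiset is a shuffle of a word \<open>w\<close> on the old one with \<open>r\<close> copies of
  the new largest letter. With \<open>d = des w\<close> and \<open>N = length w\<close>, a block of new letters inserted
  into a descent of \<open>w\<close> or at the end of \<open>w\<close> (\<open>d + 1\<close> gaps) creates no descent, while in any of
  the remaining \<open>N - d\<close> gaps it creates one. Hence \<open>(N - d choose k) * (d + r choose (r - k))\<close>
  shuffles have \<open>d + k\<close> descents. On the other side, \<open>D ^^ j / fact j\<close> applied to
  \<open>x ^ (d + 1) * y ^ (N - d)\<close> chooses \<open>j\<close> of the gaps, and Vandermonde's identity sums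
  over \<open>j\<close>.
\<close>

section \<open>Descent statistics of shuffles with copies of a largest letter\<close>

lemma des_Nil [simp]: "des [] = 0"
  by (simp add: des_def)

lemma des_singleton [simp]: "des [p] = 0"
  by (simp add: des_def)

lemma des_Cons_Cons: "des (p # x # w) = (if p > x then 1 else 0) + des (x # w)"
proof -
  let ?A = "{i. i + 1 < length (x # w) \<and> (x # w) ! i > (x # w) ! (i + 1)}"
  let ?B = "{i. i + 1 < length (p # x # w) \<and> (p # x # w) ! i > (p # x # w) ! (i + 1)}"
  have "i \<in> ?B \<longleftrightarrow> i \<in> (if p > x then {0} else {}) \<union> Suc ` ?A" for i
    by (cases i) (auto simp: image_iff)
  then have B: "?B = (if p > x then {0} else {}) \<union> Suc ` ?A"
    by blast
  have "finite ?A"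
    by (rule finite_subset[of _ "{..<length (x # w)}"]) auto
  then have "card ?B = (if p > x then 1 else 0) + card ?A"
    unfolding B by (subst card_Un_disjoint) (auto simp: card_image)
  then show ?thesis
    by (simp only: des_def)
qed

lemma des_Cons_le: "des (p # w) \<le> length w"
proof (induction w arbitrary: p)
  case (Cons x w)
  from Cons.IH[of x] show ?case by (simp add: des_Cons_Cons)
qed simp

lemma des_0_Cons [simp]: "des (0 # w) = des w"
  by (cases w) (simp_all add: des_Cons_Cons)

lemma des_le: "des w \<le> length w"
  using des_Cons_le[of 0 w] by simp

text \<open>The first letter of a shuffle comes from one of the two words;
  \<open>x \<noteq> z\<close> makes the two cases disjoint.\<close>

lemma shuffles_replicate_Cons:
  assumes "x \<noteq> z"
  shows "sum g (shuffles (x # w) (replicate (Suc r) z)) =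
    (\<Sum>u\<in>shuffles w (replicate (Suc r) z). g (x # u)) +
    (\<Sum>u\<in>shuffles (x # w) (replicate r z). g (z # u))"
proof -
  have "sum g (shuffles (x # w) (replicate (Suc r) z)) =
    sum g ((#) x ` shuffles w (replicate (Suc r) z)) +
    sum g ((#) z ` shuffles (x # w) (replicate r z))"
    using assms by (simp, subst sum.union_disjoint) auto
  then show ?thesis
    by (simp add: sum.reindex o_def)
qed

text \<open>
  Prepending an arbitrary letter \<open>p \<le> z\<close> makes the induction go through; \<open>p = 0\<close> gives the count
  for \<open>w\<close> itself.
\<close>

lemma sum_des_shuffles_replicate:
  fixes f :: "nat \<Rightarrow> 'a::comm_semiring_1"
  assumes "\<forall>x\<in>set w. x < z" "p \<le> z"
  shows "(\<Sum>u\<in>shuffles w (replicate r z). f (des (p # u))) =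
    (\<Sum>k\<le>r. of_nat ((length w - des (p # w) choose k) * (des (p # w) + r choose (r - k))) *
       f (des (p # w) + k))"
  using assms
proof (induction "length w + r" arbitrary: w r p f rule: less_induct)
  case less
  show ?case
  proof (cases w)
    case Nil
    \<comment> \<open>The only shuffle is the constant word, weakly increasing even after
      \<open>p\<close>; on the right \<open>0 choose k\<close> leaves only
      \<open>k = 0\<close>.\<close>
    have "des (q # replicate n z) = 0" if "q \<le> z" for q n
      using that by (induction n arbitrary: q) (simp_all add: des_Cons_Cons)
    moreover have "(\<Sum>k\<le>r. of_nat ((0 choose k) * (r choose (r - k))) * f k) =
        (\<Sum>k\<in>{0}. of_nat ((0 choose k) * (r choose (r - k))) * f k)"
      by (rule sum.mono_neutral_right) (auto simp: binomial_eq_0)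
    ultimately show ?thesis
      using Nil less.prems by simp
  next
    case (Cons x v)
    show ?thesis
    proof (cases r)
      case 0
      then show ?thesis by simp
    next
      case (Suc s)
      define c where "c = des (x # v)"
      define e :: nat where "e = (if p > x then 1 else 0)"
      define L where "L = length v"
      have xz: "x < z" and vz: "\<forall>y\<in>set v. y < z"
        using less.prems Cons by auto
      have cL: "c \<le> L"
        unfolding c_def L_def by (rule des_Cons_le)
      have dp: "des (p # x # u) = e + des (x # u)" for u
        by (simp add: des_Cons_Cons e_def)
      have dz: "des (z # x # v) = c + 1"
        using xz by (simp add: des_Cons_Cons c_def)
      have zz: "des (p # z # u) = des (z # u)" for u
        using less.prems by (simp add: des_Cons_Cons)
      have "(\<Sum>u\<in>shuffles w (replicate r z). f (des (p # u))) =
          (\<Sum>u\<in>shuffles v (replicate (Suc s) z). f (e + des (x # u))) +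
          (\<Sum>u\<in>shuffles (x # v) (replicate s z). f (des (z # u)))"
        unfolding Cons Suc using xz by (subst shuffles_replicate_Cons) (simp_all add: dp zz)
      \<comment> \<open>If \<open>x\<close> comes first, it becomes the new prefix, and the possible
        descent from \<open>p\<close> to \<open>x\<close> is absorbed into the weight
        function.\<close>
      also have "(\<Sum>u\<in>shuffles v (replicate (Suc s) z). f (e + des (x # u))) =
          (\<Sum>k\<le>Suc s. of_nat ((L - c choose k) * (c + Suc s choose (Suc s - k))) * f (e + (c + k)))"
        unfolding c_def L_def using less.hyps[of v "Suc s" x "\<lambda>d. f (e + d)"] xz vz Cons Suc
        by simp
      \<comment> \<open>If \<open>z\<close> comes first, it is the new prefix and
        \<open>des (z # x # v) = c + 1\<close>. Both the length and the descent number exceed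
        \<open>L\<close> and \<open>c\<close> by one, so \<open>L - c\<close> appears again, and
        \<open>c + 1 + s = c + Suc s\<close>.\<close>
      also have "(\<Sum>u\<in>shuffles (x # v) (replicate s z). f (des (z # u))) =
          (\<Sum>k\<le>s. of_nat ((L - c choose k) * (c + Suc s choose (s - k))) * f (c + Suc k))"
        using less.hyps[of "x # v" s z f] xz vz Cons Suc dz L_def by simp
      also have "(\<Sum>k\<le>Suc s. of_nat ((L - c choose k) * (c + Suc s choose (Suc s - k))) * f (e + (c + k))) +
          (\<Sum>k\<le>s. of_nat ((L - c choose k) * (c + Suc s choose (s - k))) * f (c + Suc k)) =
          (\<Sum>k\<le>Suc s. of_nat ((Suc L - (e + c) choose k) * (e + c + Suc s choose (Suc s - k))) * f (e + c + k))"
      proof (cases "p > x")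
        case True
        then have e: "e = 1" by (simp add: e_def)
        \<comment> \<open>The two sums align at equal \<open>k\<close>, and Pascal's rule acts on
          the second binomial factor.\<close>
        have "(Suc (c + Suc s) choose (Suc s - k)) =
            (c + Suc s choose (Suc s - k)) + (c + Suc s choose (s - k))" if "k \<le> s" for k
          using that by (simp add: Suc_diff_le)
        then show ?thesis
          by (simp add: e sum.distrib[symmetric] algebra_simps)
      next
        case False
        then have e: "e = 0" by (simp add: e_def)
        \<comment> \<open>Here the second sum is shifted by one in \<open>k\<close>, and Pascal's
          rule acts on the first binomial factor.\<close>
        have Suc_diff: "Suc L - c = Suc (L - c)" using cL by simp
        show ?thesis
          unfolding e add_0 Suc_diff sum.atMost_Suc_shift
          by (simp add: sum.distrib[symmetric] algebra_simps)
      qed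
      finally show ?thesis
        unfolding Cons Suc dp c_def L_def by simp
    qed
  qed
qed

section \<open>Decomposing words on the enlarged multiset\<close>

lemma permutations_of_multiset_add_replicate:
  assumes "z \<notin># M"
  shows "permutations_of_multiset (M + replicate_mset r z) =
    (\<Union>w\<in>permutations_of_multiset M. shuffles w (replicate r z))"
proof (intro equalityI subsetI)
  fix u assume "u \<in> permutations_of_multiset (M + replicate_mset r z)"
  then have u: "mset u = M + replicate_mset r z"
    by (simp add: permutations_of_multiset_def)
  \<comment> \<open>Deleting every \<open>z\<close> from \<open>u\<close> leaves a word on
    \<open>M\<close>, and the deleted letters form the constant word.\<close>
  have "filter_mset (\<lambda>x. x \<noteq> z) M = M"
    using assms by (auto intro: filter_mset_eq_conv[THEN iffD2])
  then have "mset (filter (\<lambda>x. x \<noteq> z) u) = M"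
    using u by (simp add: mset_filter)
  moreover have "filter (\<lambda>x. \<not> x \<noteq> z) u = replicate r z"
  proof -
    have "filter (\<lambda>x. \<not> x \<noteq> z) u = replicate (count (mset u) z) z"
      by (induction u) auto
    also have "count (mset u) z = r"
      using assms u by (simp add: not_in_iff)
    finally show ?thesis .
  qed
  ultimately show "u \<in> (\<Union>w\<in>permutations_of_multiset M. shuffles w (replicate r z))"
    using partition_in_shuffles[of u "\<lambda>x. x \<noteq> z"]
    by (auto simp: permutations_of_multiset_def intro!: exI[of _ "filter (\<lambda>x. x \<noteq> z) u"])
next
  fix u assume "u \<in> (\<Union>w\<in>permutations_of_multiset M. shuffles w (replicate r z))"
  then show "u \<in> permutations_of_multiset (M + replicate_mset r z)"
    by (auto simp: permutations_of_multiset_def mset_shuffles)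
qed

text \<open>The union is disjoint: \<open>w\<close> is recovered from any of its shuffles by
  deleting every \<open>z\<close>.\<close>

lemma sum_permutations_of_multiset_add_replicate:
  assumes "z \<notin># M"
  shows "sum g (permutations_of_multiset (M + replicate_mset r z)) =
    (\<Sum>w\<in>permutations_of_multiset M. sum g (shuffles w (replicate r z)))"
  unfolding permutations_of_multiset_add_replicate[OF assms]
proof (rule sum.UNION_disjoint)
  have "filter (\<lambda>x. x \<noteq> z) u = w"
    if "w \<in> permutations_of_multiset M" "u \<in> shuffles w (replicate r z)" for u w
  proof -
    have "filter (\<lambda>x. x \<noteq> z) u \<in> shuffles (filter (\<lambda>x. x \<noteq> z) w) (filter (\<lambda>x. x \<noteq> z) (replicate r z))"
      using that(2) filter_shuffles by blast
    moreover have "filter (\<lambda>x. x \<noteq> z) w = w"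
      using that(1) assms by (auto simp: permutations_of_multiset_def filter_id_conv)
    ultimately show ?thesis by simp
  qed
  then show "\<forall>w\<in>permutations_of_multiset M. \<forall>v\<in>permutations_of_multiset M. w \<noteq> v \<longrightarrow>
      shuffles w (replicate r z) \<inter> shuffles v (replicate r z) = {}"
    by blast
qed auto

lemma mult_mset_snoc: "mult_mset (m @ [r]) = mult_mset m + replicate_mset r (length m + 1)"
  by (simp add: mult_mset_def nth_append)

lemma in_mult_msetD: "x \<in># mult_mset m \<Longrightarrow> x < length m + 1"
  by (auto simp: mult_mset_def set_mset_sum split: if_splits)

lemma size_mult_mset: "size (mult_mset m) = sum_list m"
  by (induction m rule: rev_induct) (simp_all add: mult_mset_snoc, simp add: mult_mset_def)

text \<open>The convention for the empty multiset agrees with the general sum, whose only term is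
  then that of the empty word, \<open>var_x ^ 1 * var_y ^ 0\<close>.\<close>

lemma H_eq_sum:
  "H m = (\<Sum>w\<in>permutations_of_multiset (mult_mset m).
     var_x ^ (des w + 1) * var_y ^ (sum_list m - des w))"
proof (cases "mult_mset m = {#}")
  case True
  then have "sum_list m = 0"
    using size_mult_mset[of m] by simp
  then show ?thesis
    unfolding H_def True by (simp del: sum_list_eq_0_iff)
qed (simp add: H_def)

section \<open>Derivatives of monomials and the action of \<open>G\<close>\<close>

lemma const_of_nat: "const (of_nat n) = of_nat n"
  by (simp add: const_def of_nat_poly)

lemma const_mult: "const (c * d) = const c * const d"
  by (simp add: const_def)

lemma const_mult_eq_smult: "const c * p = smult [:c:] p"
  by (simp add: const_def)

lemma var_power: "var_x ^ a * var_y ^ b = monom (monom 1 a) b"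
proof -
  have "var_x ^ a = [:monom 1 a:]"
    by (induction a) (simp_all add: var_x_def monom_Suc one_pCons monom_0)
  moreover have "var_y ^ b = monom 1 b"
    by (simp add: var_y_def monom_altdef)
  ultimately show ?thesis
    by (simp add: smult_monom)
qed

lemma D_0 [simp]: "D 0 = 0"
  by (simp add: D_def partial_x_def partial_y_def)

lemma D_add: "D (p + q) = D p + D q"
proof -
  have "partial_x (p + q) = partial_x p + partial_x q"
    by (rule poly_eqI) (simp add: partial_x_def coeff_map_poly pderiv_add)
  then show ?thesis
    by (simp add: D_def partial_y_def pderiv_add)
qed

lemma D_sum: "D (sum f A) = (\<Sum>i\<in>A. D (f i))"
  by (induction A rule: infinite_finite_induct) (simp_all add: D_add)

lemma D_funpow_sum: "(D ^^ j) (sum f A) = (\<Sum>i\<in>A. (D ^^ j) (f i))"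
  by (induction j) (simp_all add: D_sum)

lemma D_const_mult: "D (const c * p) = const c * D p"
proof -
  have "partial_x (smult [:c:] p) = smult [:c:] (partial_x p)"
    by (rule poly_eqI) (simp add: partial_x_def coeff_map_poly pderiv_smult)
  then show ?thesis
    by (simp add: const_mult_eq_smult D_def partial_y_def pderiv_smult smult_add_right)
qed

lemma D_of_nat_mult: "D (of_nat n * p) = of_nat n * D p"
  using D_const_mult[of "of_nat n" p] by (simp add: const_of_nat)

lemma D_monomial:
  "D (var_x ^ a * var_y ^ b) =
    of_nat a * (var_x ^ (a - 1) * var_y ^ b) + of_nat b * (var_x ^ a * var_y ^ (b - 1))"
proof -
  have "of_nat n * p = smult (of_nat n) p" for n and p :: bipoly
    by (simp add: of_nat_poly)
  moreover have "(of_nat n :: rat poly) * monom 1 i = monom (of_nat n) i" for n i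
    by (simp add: of_nat_poly smult_monom)
  ultimately show ?thesis
    by (simp add: var_power D_def partial_x_def partial_y_def map_poly_monom pderiv_monom
        smult_monom)
qed

text \<open>Both sides count the k-subsets of an n-set together with one further element
  outside.\<close>

lemma binomial_absorb_diff: "(n choose k) * (n - k) = Suc k * (n choose Suc k)"
  using binomial_absorb_comp[of n k] binomial_absorption[of k n]
  by (simp add: mult.commute)

text \<open>This is the binomial expansion of a power of the sum of two commuting derivations, with
  the factorials pulled out. Truncated exponents are harmless because their binomial coefficients
  vanish.\<close>

lemma D_funpow_monomial:
  "(D ^^ j) (var_x ^ a * var_y ^ b) = of_nat (fact j) *
    (\<Sum>i\<le>j. of_nat ((a choose (j - i)) * (b choose i)) * (var_x ^ (a - (j - i)) * var_y ^ (b - i)))"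
proof (induction j)
  case 0
  show ?case by simp
next
  case (Suc j)
  define T where "T i = of_nat ((a choose (Suc j - i)) * (b choose i)) *
    (var_x ^ (a - (Suc j - i)) * var_y ^ (b - i))" for i
  \<comment> \<open>Differentiating the old term \<open>i\<close> in x feeds the new term
    \<open>T i\<close>, and in y the new term \<open>T (Suc i)\<close>.\<close>
  have step: "D (of_nat ((a choose (j - i)) * (b choose i)) * (var_x ^ (a - (j - i)) * var_y ^ (b - i))) =
      of_nat (Suc j - i) * T i + of_nat (Suc i) * T (Suc i)" if "i \<le> j" for i
  proof -
    have 1: "(a choose (j - i)) * (a - (j - i)) = (Suc j - i) * (a choose (Suc j - i))"
      using binomial_absorb_diff[of a "j - i"] that by (simp add: Suc_diff_le)
    have 2: "(b choose i) * (b - i) = Suc i * (b choose Suc i)"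
      by (rule binomial_absorb_diff)
    have e: "a - (j - i) - 1 = a - (Suc j - i)" "b - i - 1 = b - Suc i"
      using that by simp_all
    have "D (of_nat ((a choose (j - i)) * (b choose i)) * (var_x ^ (a - (j - i)) * var_y ^ (b - i))) =
        of_nat ((a choose (j - i)) * (a - (j - i)) * (b choose i)) *
          (var_x ^ (a - (Suc j - i)) * var_y ^ (b - i)) +
        of_nat ((a choose (j - i)) * ((b choose i) * (b - i))) *
          (var_x ^ (a - (j - i)) * var_y ^ (b - Suc i))"
      unfolding D_of_nat_mult D_monomial e by (simp only: of_nat_mult distrib_left mult_ac)
    then show ?thesis
      unfolding 1 2 T_def by (simp only: of_nat_mult mult_ac diff_Suc_Suc)
  qed
  have "D (\<Sum>i\<le>j. of_nat ((a choose (j - i)) * (b choose i)) * (var_x ^ (a - (j - i)) * var_y ^ (b - i))) =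
      (\<Sum>i\<le>j. of_nat (Suc j - i) * T i) + (\<Sum>i\<le>j. of_nat (Suc i) * T (Suc i))"
    unfolding D_sum sum.distrib[symmetric] by (rule sum.cong) (simp_all only: step atMost_iff)
  \<comment> \<open>Both sums extend to \<open>i \<le> Suc j\<close> by a term with coefficient
    zero; then the coefficients of each \<open>T i\<close> add up to \<open>Suc j\<close>.\<close>
  also have "(\<Sum>i\<le>j. of_nat (Suc j - i) * T i) = (\<Sum>i\<le>Suc j. of_nat (Suc j - i) * T i)"
    by simp
  also have "(\<Sum>i\<le>j. of_nat (Suc i) * T (Suc i)) = (\<Sum>i\<le>Suc j. of_nat i * T i)"
    by (subst sum.atMost_Suc_shift) simp
  also have "(\<Sum>i\<le>Suc j. of_nat (Suc j - i) * T i) + (\<Sum>i\<le>Suc j. of_nat i * T i) =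
      (\<Sum>i\<le>Suc j. of_nat (Suc j) * T i)"
    unfolding sum.distrib[symmetric]
    by (intro sum.cong refl) (simp del: of_nat_Suc add: distrib_right[symmetric] of_nat_add[symmetric])
  finally have "(D ^^ Suc j) (var_x ^ a * var_y ^ b) =
      of_nat (fact j) * (\<Sum>i\<le>Suc j. of_nat (Suc j) * T i)"
    using Suc.IH by (simp only: funpow.simps o_apply D_of_nat_mult)
  then show ?case
    unfolding T_def by (simp only: sum_distrib_left[symmetric] fact_Suc of_nat_mult mult_ac of_nat_id)
qed

lemma const_D_funpow_monomial:
  "const (of_nat n / fact j) * var_x ^ j * (D ^^ j) (var_x ^ a * var_y ^ b) =
    (\<Sum>i\<le>j. of_nat (n * (a choose (j - i)) * (b choose i)) * (var_x ^ (a + i) * var_y ^ (b - i)))"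
proof -
  have c: "const (of_nat n / fact j) * of_nat (fact j) = of_nat n"
    by (simp add: const_of_nat[symmetric] const_mult[symmetric])
  have "var_x ^ j * (of_nat ((a choose (j - i)) * (b choose i)) *
        (var_x ^ (a - (j - i)) * var_y ^ (b - i))) =
      of_nat ((a choose (j - i)) * (b choose i)) * (var_x ^ (a + i) * var_y ^ (b - i))"
    if "i \<le> j" for i
  proof (cases "j - i \<le> a")
    case True
    then have "a + i = j + (a - (j - i))" using that by simp
    then show ?thesis by (simp only: power_add mult_ac)
  qed (simp add: binomial_eq_0)
  then have s: "var_x ^ j * (\<Sum>i\<le>j. of_nat ((a choose (j - i)) * (b choose i)) *
        (var_x ^ (a - (j - i)) * var_y ^ (b - i))) =
      (\<Sum>i\<le>j. of_nat ((a choose (j - i)) * (b choose i)) * (var_x ^ (a + i) * var_y ^ (b - i)))"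
    unfolding sum_distrib_left by (intro sum.cong) (simp_all only: atMost_iff)
  have "const (of_nat n / fact j) * var_x ^ j * (D ^^ j) (var_x ^ a * var_y ^ b) =
      (const (of_nat n / fact j) * of_nat (fact j)) *
      (var_x ^ j * (\<Sum>i\<le>j. of_nat ((a choose (j - i)) * (b choose i)) *
        (var_x ^ (a - (j - i)) * var_y ^ (b - i))))"
    unfolding D_funpow_monomial by (simp only: mult_ac)
  then show ?thesis
    unfolding c s by (simp add: sum_distrib_left mult.assoc)
qed

text \<open>Vandermonde's identity after the reflection \<open>k = r - j\<close>. The lower bound
  \<open>max 1 i\<close> keeps out \<open>j < i\<close>, where truncated subtraction would give the
  binomial 1 instead of 0.\<close>

lemma vandermonde_shifted:
  assumes "r \<ge> 1" "i \<le> r"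
  shows "(\<Sum>j\<in>{max 1 i..r}. (r - 1 choose (j - 1)) * (a choose (j - i))) = (a + r - 1 choose (r - i))"
proof -
  have sym: "(r - 1 choose (r - j)) = (r - 1 choose (j - 1))" if "1 \<le> j" "j \<le> r" for j
    using binomial_symmetric[of "j - 1" "r - 1"] that by simp
  have "(\<Sum>j\<in>{max 1 i..r}. (r - 1 choose (j - 1)) * (a choose (j - i))) =
      (\<Sum>k\<le>r - i. (r - 1 choose k) * (a choose (r - i - k)))"
    using assms
    \<comment> \<open>The only index without a partner is \<open>k = r\<close>, possible when
      \<open>i = 0\<close>; its term contains \<open>r - 1 choose r\<close>, which is 0.\<close>
    by (intro sum.reindex_bij_witness_not_neutral
          [where S' = "{}" and T' = "{k. k \<le> r - i \<and> r - 1 < k}" and i = "\<lambda>k. r - k" and j = "\<lambda>j. r - j"])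
       (use sym in \<open>auto simp: binomial_eq_0\<close>)
  also have "\<dots> = (r - 1 + a choose (r - i))"
    by (rule vandermonde)
  finally show ?thesis
    using assms by (simp add: add.commute)
qed

lemma G_sum: "G r (sum f A) = (\<Sum>w\<in>A. G r (f w))"
  unfolding G_def D_funpow_sum sum_distrib_left by (subst sum.swap) simp

lemma G_monomial:
  assumes "r \<ge> 1"
  shows "G r (var_x ^ (d + 1) * var_y ^ b) =
    (\<Sum>k\<le>r. of_nat ((b choose k) * (d + r choose (r - k))) *
       (var_x ^ (d + k + 1) * var_y ^ (b + r - k)))"
proof -
  define F where "F i = (var_x :: bipoly) ^ (d + i + 1) * var_y ^ (b - i)" for i
  have "(\<Sum>j=1..r. const (of_nat (r - 1 choose (j - 1)) / fact j) * var_x ^ j *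
        (D ^^ j) (var_x ^ (d + 1) * var_y ^ b)) =
      (\<Sum>j=1..r. \<Sum>i\<le>j. of_nat ((r - 1 choose (j - 1)) * (d + 1 choose (j - i)) * (b choose i)) * F i)"
    unfolding const_D_funpow_monomial F_def by (simp add: ac_simps)
  \<comment> \<open>Interchanging the order of summation isolates the exponent of x, which depends
    on \<open>i\<close> only.\<close>
  also have "\<dots> = (\<Sum>i\<le>r. \<Sum>j\<in>{max 1 i..r}.
      of_nat ((r - 1 choose (j - 1)) * (d + 1 choose (j - i)) * (b choose i)) * F i)"
    unfolding sum.Sigma[OF finite_atLeastAtMost ballI[OF finite_atMost]]
      sum.Sigma[OF finite_atMost ballI[OF finite_atLeastAtMost]]
    by (rule sum.reindex_bij_witness[where i = prod.swap and j = prod.swap]) auto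
  also have "\<dots> = (\<Sum>i\<le>r. of_nat ((b choose i) * (d + r choose (r - i))) * F i)"
  proof (rule sum.cong)
    fix i assume "i \<in> {..r}"
    then have "(\<Sum>j\<in>{max 1 i..r}. (r - 1 choose (j - 1)) * (d + 1 choose (j - i))) = (d + r choose (r - i))"
      using vandermonde_shifted[of r i "d + 1"] assms by simp
    then show "(\<Sum>j\<in>{max 1 i..r}.
        of_nat ((r - 1 choose (j - 1)) * (d + 1 choose (j - i)) * (b choose i)) * F i) =
        of_nat ((b choose i) * (d + r choose (r - i))) * F i"
      unfolding sum_distrib_right[symmetric] of_nat_sum[symmetric] by (simp only: mult_ac)
  qed simp
  finally have "G r (var_x ^ (d + 1) * var_y ^ b) =
      (\<Sum>i\<le>r. of_nat ((b choose i) * (d + r choose (r - i))) * (var_y ^ r * F i))"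
    unfolding G_def by (simp only: sum_distrib_left mult_ac)
  also have "\<dots> = (\<Sum>k\<le>r. of_nat ((b choose k) * (d + r choose (r - k))) *
      (var_x ^ (d + k + 1) * var_y ^ (b + r - k)))"
  proof (rule sum.cong)
    fix k
    show "of_nat ((b choose k) * (d + r choose (r - k))) * (var_y ^ r * F k) =
      of_nat ((b choose k) * (d + r choose (r - k))) *
      (var_x ^ (d + k + 1) * var_y ^ (b + r - k))"
    \<comment> \<open>For \<open>k > b\<close> the exponents of y may differ, since subtraction
      truncates, but \<open>b choose k\<close> is 0.\<close>
    proof (cases "k \<le> b")
      case True
      then have "b + r - k = r + (b - k)" by simp
      then show ?thesis by (simp only: F_def power_add mult_ac)
    qed (simp add: binomial_eq_0)
  qed simp
  finally show ?thesis .
qed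

section \<open>Comparing the two sides word by word\<close>

theorem proposition1:
  fixes m :: "nat list" and r :: nat
  assumes "r \<ge> 1"
  shows "H (m @ [r]) = G r (H m)"
proof -
  define z where "z = length m + 1"
  define N where "N = sum_list m"
  \<comment> \<open>The weight of a word of length \<open>N + r\<close> with \<open>d\<close>
    descents.\<close>
  define f where "f d = (var_x :: bipoly) ^ (d + 1) * var_y ^ (N + r - d)" for d
  have "z \<notin># mult_mset m"
    using in_mult_msetD[of z m] by (auto simp: z_def)
  then have "H (m @ [r]) =
      (\<Sum>w\<in>permutations_of_multiset (mult_mset m). \<Sum>u\<in>shuffles w (replicate r z). f (des u))"
    unfolding H_eq_sum mult_mset_snoc z_def[symmetric]
    by (subst sum_permutations_of_multiset_add_replicate) (simp_all add: f_def N_def)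
  also have "\<dots> = (\<Sum>w\<in>permutations_of_multiset (mult_mset m).
      G r (var_x ^ (des w + 1) * var_y ^ (N - des w)))"
  proof (rule sum.cong)
    fix w assume "w \<in> permutations_of_multiset (mult_mset m)"
    then have w: "mset w = mult_mset m"
      by (simp add: permutations_of_multiset_def)
    then have len: "length w = N"
      by (metis size_mset size_mult_mset N_def)
    have "\<forall>x\<in>set w. x < z"
      using w in_mult_msetD by (metis set_mset_mset z_def)
    from sum_des_shuffles_replicate[OF this, where p = 0 and r = r and f = f]
    have "(\<Sum>u\<in>shuffles w (replicate r z). f (des u)) =
        (\<Sum>k\<le>r. of_nat ((N - des w choose k) * (des w + r choose (r - k))) * f (des w + k))"
      by (simp add: len)
    also have "\<dots> = G r (var_x ^ (des w + 1) * var_y ^ (N - des w))"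
      \<comment> \<open>The bound \<open>des w \<le> N\<close> makes
        \<open>N - des w + r - k\<close> equal to \<open>N + r - (des w + k)\<close>.\<close>
      unfolding G_monomial[OF assms] f_def using des_le[of w] len by simp
    finally show "(\<Sum>u\<in>shuffles w (replicate r z). f (des u)) = \<dots>" .
  qed simp
  also have "\<dots> = G r (H m)"
    unfolding H_eq_sum G_sum N_def ..
  finally show ?thesis .
qed

end
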